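(* Let $k$ be a positive integer and let $G$ be a finite directed graph in which each vertex has at most $k$ out-neighbors, and at least $1$. Then there is a finite monoid $M$ and a subset $C\subseteq M$ with $|C|=k$ such that $G\cong \mathrm{Cay}(M,C)\setminus \mathrm{Cay}(M,C)_e$, where $e$ is the neutral element of $M$.
   Context: All monoids and digraphs are finite. Directed graphs may have loops and anti-parallel arcs but no parallel arcs (a vertex with a loop is an out-neighbor of itself). For a monoid $M$ and $C\subseteq M$, $\mathrm{Cay}(M,C)$ is the directed graph with vertex set $M$ and arc set $\{(s,sc)\mid s\in M,\ c\in C\}$. For a digraph $H$ and a vertex $v$, $H_v$ denotes the connected component (with respect to the underlying undirected graph) of $H$ containing $v$, and $H\setminus H_v$ is the digraph obtained by removing this component. *)

theory Defs
  imports "Graph_Theory.Digraph_Isomorphism" "HOL-Algebra.Group"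
begin

definition cayley_digraph :: "('m, 'x) monoid_scheme \<Rightarrow> 'm set \<Rightarrow> 'm pair_pre_digraph" where
  "cayley_digraph M C =
    \<lparr> pverts = carrier M,
      parcs = {(s, s \<otimes>\<^bsub>M\<^esub> c) | s c. s \<in> carrier M \<and> c \<in> C} \<rparr>"

definition out_neighbors :: "('a, 'b) pre_digraph \<Rightarrow> 'a \<Rightarrow> 'a set" where
  "out_neighbors H v = {w. v \<rightarrow>\<^bsub>H\<^esub> w}"

text \<open>Components are those of the underlying undirected graph: reachability is taken in the
  symmetric closure \<^const>\<open>mk_symmetric\<close>, whereas the component itself keeps the directed
  arcs of \<open>H\<close>.\<close>

definition component_at :: "('a, 'b) pre_digraph \<Rightarrow> 'a \<Rightarrow> ('a, 'b) pre_digraph" where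
  "component_at H v = H \<restriction> {u. v \<rightarrow>\<^sup>*\<^bsub>with_proj (mk_symmetric H)\<^esub> u}"

definition remove_component :: "('a, 'b) pre_digraph \<Rightarrow> 'a \<Rightarrow> ('a, 'b) pre_digraph" where
  "remove_component H v = H \<restriction> (verts H - verts (component_at H v))"

end

theory Submission
  imports Defs
begin

text \<open>Let \<open>f\<^sub>0, \<dots>, f\<^sub>k\<^sub>-\<^sub>1\<close> be self-maps of the vertex set \<open>V\<close> whose values at each vertex \<open>v\<close> are
  exactly the out-neighbors of \<open>v\<close>. Extend \<open>f\<^sub>i\<close> to a transformation \<open>c\<^sub>i\<close> of the disjoint union of
  \<open>V\<close> and \<open>\<nat>\<close> that is constantly \<open>i\<close> off \<open>V\<close>; this makes the \<open>c\<^sub>i\<close> pairwise distinct and keeps the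
  transformations generated by them apart from the constant maps with value in \<open>V\<close>. These two sets
  together form a monoid of transformations acting on the right. In its Cayley digraph with respect to
  \<open>C = {c\<^sub>i | i < k}\<close>, the generated transformations are the component of the identity, and on the
  constant maps the arcs are those of the given digraph, since \<open>v\<close> followed by \<open>c\<^sub>i\<close> is \<open>f\<^sub>i v\<close>.\<close>

section \<open>The component of the identity in a Cayley digraph, and what its removal
  leaves\<close>

lemma verts_component_at_cayley_one:
  fixes M (structure)
  assumes "monoid M" "C \<subseteq> carrier M" "\<one> \<in> S"
    and closed: "\<And>s c. s \<in> carrier M \<Longrightarrow> c \<in> C \<Longrightarrow> s \<otimes> c \<in> S \<longleftrightarrow> s \<in> S"
    and reach: "\<And>s. s \<in> S \<Longrightarrow> (\<one>, s) \<in> (parcs (cayley_digraph M C))\<^sup>*"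
  shows "verts (component_at (with_proj (cayley_digraph M C)) \<one>) = S"
proof -
  interpret monoid M by fact
  define H where "H = with_proj (cayley_digraph M C)"
  have H: "verts H = carrier M"
    "arcs_ends H = parcs (cayley_digraph M C)"
    by (auto simp: H_def cayley_digraph_def)
  interpret wf_digraph H
    using \<open>C \<subseteq> carrier M\<close> by unfold_locales (auto simp: H_def cayley_digraph_def)
  \<comment> \<open>Membership in \<open>S\<close> is the same at both ends of every arc, so an
    undirected walk starting at \<open>\<one>\<close> cannot leave \<open>S\<close>.\<close>
  have "u \<in> S" if "\<one> \<rightarrow>\<^sup>*\<^bsub>with_proj (mk_symmetric H)\<^esub> u" for u
    using that unfolding reachable_def
  proof (induct rule: rtrancl_on_induct)
    case (step y z)
    then obtain s c where "s \<in> carrier M" "c \<in> C" "(y, z) = (s, s \<otimes> c) \<or> (y, z) = (s \<otimes> c, s)"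
      by (auto simp: parcs_mk_symmetric H_def cayley_digraph_def)
    with \<open>y \<in> S\<close> show ?case
      using closed by blast
  qed (use \<open>\<one> \<in> S\<close> in simp)
  moreover have "\<one> \<rightarrow>\<^sup>*\<^bsub>with_proj (mk_symmetric H)\<^esub> u" if "u \<in> S" for u
  proof -
    \<comment> \<open>\<open>reachable_def\<close> requires walks whose vertices lie in the digraph,
      so the plain closure from \<open>reach\<close> is rebuilt inside
      \<open>carrier M\<close>.\<close>
    have "(\<one>, u) \<in> rtrancl_on (carrier M) (parcs (cayley_digraph M C))"
      using reach[OF that]
    proof induct
      case (step y z)
      moreover from \<open>(y, z) \<in> _\<close> have "z \<in> carrier M"
        using \<open>C \<subseteq> carrier M\<close> by (auto simp: cayley_digraph_def)
      ultimately show ?case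
        by (meson rtrancl_on_into_rtrancl_on)
    qed auto
    then have "\<one> \<rightarrow>\<^sup>*\<^bsub>H\<^esub> u"
      by (simp add: reachable_def H)
    then show ?thesis
      by (rule reachable_mk_symmetricI)
  qed
  ultimately show ?thesis
    by (auto simp: component_at_def H_def)
qed

text \<open>Arcs are pairs of vertices, so an injective vertex map also fixes the arc map. The
  condition \<open>arcs\<close> goes one tail at a time, the form in which right multiplication by
  generators supplies it.\<close>

lemma digraph_iso_with_proj_restrict:
  assumes "pair_wf_digraph G" "inj_on \<psi> (pverts G)"
    and "X = \<psi> ` pverts G"
    and arcs: "\<And>u w. u \<in> pverts G \<Longrightarrow>
      (\<psi> u, w) \<in> parcs H \<and> w \<in> X \<longleftrightarrow> (\<exists>v. w = \<psi> v \<and> (u, v) \<in> parcs G)"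
  shows "digraph_iso (with_proj G) (with_proj H \<restriction> X)"
proof -
  interpret pair_wf_digraph G by fact
  define \<phi> where "\<phi> = \<lparr>iso_verts = \<psi>, iso_arcs = map_prod \<psi> \<psi>, iso_head = snd, iso_tail = fst\<rparr>"
  have "inj_on (map_prod \<psi> \<psi>) (parcs G)"
    using map_prod_inj_on[OF assms(2,2)]
    by (rule inj_on_subset) (auto dest: in_arcsD1 in_arcsD2)
  then have "digraph_isomorphism \<phi>"
    using \<open>inj_on \<psi> (pverts G)\<close> wf_digraph by (auto simp: digraph_isomorphism_def \<phi>_def)
  moreover have "{e \<in> parcs H. fst e \<in> X \<and> snd e \<in> X} = map_prod \<psi> \<psi> ` parcs G"
  proof (intro equalityI subsetI)
    fix e assume "e \<in> {e \<in> parcs H. fst e \<in> X \<and> snd e \<in> X}"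
    then obtain u w where "e = (\<psi> u, w)" "u \<in> pverts G" "(\<psi> u, w) \<in> parcs H \<and> w \<in> X"
      unfolding \<open>X = \<psi> ` pverts G\<close> by (cases e) auto
    then show "e \<in> map_prod \<psi> \<psi> ` parcs G"
      using arcs[of u w] by auto
  next
    fix e assume "e \<in> map_prod \<psi> \<psi> ` parcs G"
    then obtain u v where "e = (\<psi> u, \<psi> v)" "(u, v) \<in> parcs G"
      by auto
    then show "e \<in> {e \<in> parcs H. fst e \<in> X \<and> snd e \<in> X}"
      using arcs[of u "\<psi> v"] in_arcsD1 \<open>X = \<psi> ` pverts G\<close> by auto
  qed
  then have "with_proj H \<restriction> X = app_iso \<phi> (with_proj G)"
    using \<open>X = \<psi> ` pverts G\<close>
    by (auto simp: induce_subgraph_def app_iso_def \<phi>_def)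
  ultimately show ?thesis
    unfolding digraph_iso_def by blast
qed

text \<open>Right multiplication by \<open>C\<close> preserves \<open>S\<close> by
  \<open>closed\<close>, and the copy of \<open>G\<close> by \<open>action\<close>, because
  out-neighbors are vertices. So no arc joins the two blocks, \<open>reach\<close> makes
  \<open>S\<close> a single component, and \<open>action\<close> describes the arcs that
  remain.\<close>

lemma remove_component_cayley_one_iso:
  fixes M (structure)
  assumes "monoid M" "C \<subseteq> carrier M" "pair_wf_digraph G" "inj_on \<psi> (pverts G)"
    and carrier: "carrier M = S \<union> \<psi> ` pverts G" and disj: "S \<inter> \<psi> ` pverts G = {}"
    and "\<one> \<in> S"
    and closed: "\<And>s c. s \<in> S \<Longrightarrow> c \<in> C \<Longrightarrow> s \<otimes> c \<in> S"
    and reach: "\<And>s. s \<in> S \<Longrightarrow> (\<one>, s) \<in> (parcs (cayley_digraph M C))\<^sup>*"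
    and action: "\<And>v. v \<in> pverts G \<Longrightarrow>
      (\<lambda>c. \<psi> v \<otimes> c) ` C = \<psi> ` out_neighbors (with_proj G) v"
  shows "digraph_iso (with_proj G) (remove_component (with_proj (cayley_digraph M C)) \<one>)"
proof -
  interpret G: pair_wf_digraph G by fact
  have nbrs: "out_neighbors (with_proj G) v = {w. (v, w) \<in> parcs G}" for v
    by (simp add: out_neighbors_def)
  have "s \<otimes> c \<in> \<psi> ` pverts G" if s: "s \<in> \<psi> ` pverts G" and c: "c \<in> C" for s c
  proof -
    obtain v where v: "s = \<psi> v" "v \<in> pverts G"
      using s by blast
    then have "s \<otimes> c \<in> \<psi> ` out_neighbors (with_proj G) v"
      using c action[OF \<open>v \<in> pverts G\<close>] by blast
    then show ?thesis
      by (auto simp: nbrs dest: G.in_arcsD2)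
  qed
  then have "s \<otimes> c \<in> S \<longleftrightarrow> s \<in> S" if "s \<in> carrier M" "c \<in> C" for s c
    using that(1)[unfolded carrier] disj closed[of s c] that(2) by (meson UnE disjoint_iff)
  then have "verts (component_at (with_proj (cayley_digraph M C)) \<one>) = S"
    using carrier by (intro verts_component_at_cayley_one reach assms(1,2,7)) simp_all
  then have *: "remove_component (with_proj (cayley_digraph M C)) \<one>
      = with_proj (cayley_digraph M C) \<restriction> (\<psi> ` pverts G)"
    using carrier disj
    by (simp add: remove_component_def cayley_digraph_def Un_Diff Diff_triv Int_commute)
  show ?thesis
    unfolding *
  proof (rule digraph_iso_with_proj_restrict)
    fix u w assume "u \<in> pverts G"
    then have "(\<psi> u, w) \<in> parcs (cayley_digraph M C) \<longleftrightarrow> w \<in> (\<lambda>c. \<psi> u \<otimes> c) ` C"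
      using carrier by (auto simp: cayley_digraph_def)
    also have "\<dots> \<longleftrightarrow> (\<exists>v. w = \<psi> v \<and> (u, v) \<in> parcs G)"
      by (auto simp: action[OF \<open>u \<in> pverts G\<close>] nbrs)
    finally show "(\<psi> u, w) \<in> parcs (cayley_digraph M C) \<and> w \<in> \<psi> ` pverts G \<longleftrightarrow>
        (\<exists>v. w = \<psi> v \<and> (u, v) \<in> parcs G)"
      by (auto dest: G.in_arcsD2)
  qed (use assms in \<open>auto simp: cayley_digraph_def\<close>)
qed

section \<open>Transport of the construction to a monoid of natural numbers\<close>

lemma finite_monoid_iso_nat:
  assumes "monoid M" "finite (carrier M)"
  obtains N :: "nat monoid" and h where "monoid N" "h \<in> iso M N" "h \<one>\<^bsub>M\<^esub> = \<one>\<^bsub>N\<^esub>"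
proof -
  interpret monoid M by fact
  obtain h :: "_ \<Rightarrow> nat" where h: "inj_on h (carrier M)"
    using finite_imp_inj_to_nat_seg[OF \<open>finite (carrier M)\<close>] by blast
  define g where "g = inv_into (carrier M) h"
  define N where "N = \<lparr>carrier = h ` carrier M, mult = \<lambda>x y. h (g x \<otimes>\<^bsub>M\<^esub> g y), one = h \<one>\<^bsub>M\<^esub>\<rparr>"
  have [simp]: "g (h x) = x" if "x \<in> carrier M" for x
    using h that by (simp add: g_def)
  have "monoid N"
    by unfold_locales (auto simp: N_def m_assoc)
  moreover have "h \<in> iso M N"
    using h by (auto simp: iso_def hom_def bij_betw_def N_def)
  ultimately show ?thesis
    by (rule that) (simp add: N_def)
qed

text \<open>The hypotheses involve only products, the identity and arcs, all of which an isomorphism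
  carries along. Its injectivity keeps the two blocks disjoint and preserves the number of
  generators.\<close>

lemma remove_component_cayley_one_iso_nat:
  fixes M (structure)
  assumes "monoid M" "finite (carrier M)" "C \<subseteq> carrier M" "pair_wf_digraph G"
    and \<psi>: "inj_on \<psi> (pverts G)"
    and carrier: "carrier M = S \<union> \<psi> ` pverts G" and disj: "S \<inter> \<psi> ` pverts G = {}"
    and "\<one> \<in> S"
    and closed: "\<And>s c. s \<in> S \<Longrightarrow> c \<in> C \<Longrightarrow> s \<otimes> c \<in> S"
    and reach: "\<And>s. s \<in> S \<Longrightarrow> (\<one>, s) \<in> (parcs (cayley_digraph M C))\<^sup>*"
    and action: "\<And>v. v \<in> pverts G \<Longrightarrow>
      (\<lambda>c. \<psi> v \<otimes> c) ` C = \<psi> ` out_neighbors (with_proj G) v"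
  shows "\<exists>(N :: nat monoid) D. monoid N \<and> finite (carrier N) \<and> D \<subseteq> carrier N \<and> card D = card C \<and>
    digraph_iso (with_proj G) (remove_component (with_proj (cayley_digraph N D)) \<one>\<^bsub>N\<^esub>)"
proof -
  obtain N :: "nat monoid" and h
    where "monoid N" and iso: "h \<in> iso M N" and one: "h \<one> = \<one>\<^bsub>N\<^esub>"
    using finite_monoid_iso_nat assms(1,2) by blast
  have inj: "inj_on h (carrier M)" and img: "carrier N = h ` carrier M"
    using iso by (auto simp: iso_def bij_betw_def)
  have mult: "h (x \<otimes> y) = h x \<otimes>\<^bsub>N\<^esub> h y" if "x \<in> carrier M" "y \<in> carrier M" for x y
    using iso that by (auto simp: iso_def hom_def)
  have "digraph_iso (with_proj G) (remove_component (with_proj (cayley_digraph N (h ` C))) \<one>\<^bsub>N\<^esub>)"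
  proof (rule remove_component_cayley_one_iso[where \<psi> = "h \<circ> \<psi>" and S = "h ` S"])
    show "h ` C \<subseteq> carrier N"
      using \<open>C \<subseteq> carrier M\<close> img by auto
    show "inj_on (h \<circ> \<psi>) (pverts G)"
      using \<psi> inj carrier by (auto intro!: comp_inj_on elim: inj_on_subset)
    show "h ` S \<inter> (h \<circ> \<psi>) ` pverts G = {}"
    proof -
      have "h ` S \<inter> h ` \<psi> ` pverts G = h ` (S \<inter> \<psi> ` pverts G)"
        using inj carrier by (intro inj_on_image_Int[symmetric, where C = "carrier M"]) auto
      then show ?thesis
        using disj by (simp add: image_comp)
    qed
    show "\<one>\<^bsub>N\<^esub> \<in> h ` S"
      using \<open>\<one> \<in> S\<close> one by (metis imageI)
    show "s \<otimes>\<^bsub>N\<^esub> c \<in> h ` S" if "s \<in> h ` S" "c \<in> h ` C" for s c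
    proof -
      obtain s' c' where *: "s = h s'" "c = h c'" "s' \<in> S" "c' \<in> C"
        using \<open>s \<in> h ` S\<close> \<open>c \<in> h ` C\<close> by blast
      then have "s \<otimes>\<^bsub>N\<^esub> c = h (s' \<otimes> c')"
        using carrier \<open>C \<subseteq> carrier M\<close> mult by auto
      then show ?thesis
        using closed * by simp
    qed
    show "(\<one>\<^bsub>N\<^esub>, s) \<in> (parcs (cayley_digraph N (h ` C)))\<^sup>*" if s: "s \<in> h ` S" for s
    proof -
      obtain s' where s': "s = h s'" "s' \<in> S"
        using s by blast
      have "(h \<one>, h s') \<in> (parcs (cayley_digraph N (h ` C)))\<^sup>*"
        using reach[OF \<open>s' \<in> S\<close>]
      proof induct
        case (step x y)
        then have "(h x, h y) \<in> parcs (cayley_digraph N (h ` C))"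
          using mult \<open>C \<subseteq> carrier M\<close> by (auto simp: cayley_digraph_def img)
        with step show ?case
          by auto
      qed simp
      then show ?thesis
        by (simp add: one s')
    qed
    show "(\<lambda>c. (h \<circ> \<psi>) v \<otimes>\<^bsub>N\<^esub> c) ` h ` C = (h \<circ> \<psi>) ` out_neighbors (with_proj G) v"
      if v: "v \<in> pverts G" for v
    proof -
      have "(\<lambda>c. (h \<circ> \<psi>) v \<otimes>\<^bsub>N\<^esub> c) ` h ` C = h ` (\<lambda>c. \<psi> v \<otimes> c) ` C"
        using mult v carrier \<open>C \<subseteq> carrier M\<close> by (auto simp: image_image intro!: image_cong)
      then show ?thesis
        by (simp add: action[OF v] image_comp)
    qed
  qed (use \<open>monoid N\<close> \<open>pair_wf_digraph G\<close> carrier in \<open>auto simp: img image_Un image_comp\<close>)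
  moreover have "card (h ` C) = card C"
    using inj \<open>C \<subseteq> carrier M\<close> by (auto intro: card_image inj_on_subset)
  ultimately show ?thesis
    using \<open>monoid N\<close> \<open>finite (carrier M)\<close> \<open>C \<subseteq> carrier M\<close>
    by (intro exI[of _ N] exI[of _ "h ` C"]) (auto simp: img)
qed

section \<open>Enumerated out-neighbors and the transformations generated from them\<close>

lemma ex_enumeration_of_card_le:
  fixes A :: "'a set" and k :: nat
  assumes "1 \<le> card A" "card A \<le> k"
  shows "\<exists>f. f ` {..<k} = A"
proof -
  have "finite A" "0 < card A"
    using assms by (auto intro: card_ge_0_finite)
  then obtain g where g: "g ` {..<card A} = A"
    by (metis ex_bij_betw_nat_finite bij_betw_imp_surj_on atLeast0LessThan)
  \<comment> \<open>Surplus indices repeat \<open>g 0\<close>, which lies in \<open>A\<close>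
    because \<open>A\<close> is nonempty.\<close>
  have "(\<lambda>i. if i < card A then g i else g 0) ` {..<k} = g ` {..<card A}" (is "?f ` _ = _")
    using assms by force
  then show ?thesis
    unfolding g by (intro exI[of _ ?f])
qed

text \<open>The generated submonoid. A new generator is applied last, so with maps acting on the
  right each \<open>step\<close> follows one arc of the Cayley digraph.\<close>

inductive_set transf_words :: "('b \<Rightarrow> 'b) set \<Rightarrow> ('b \<Rightarrow> 'b) set" for F where
  id: "id \<in> transf_words F"
| step: "x \<in> transf_words F \<Longrightarrow> c \<in> F \<Longrightarrow> c \<circ> x \<in> transf_words F"

lemma transf_words_comp:
  assumes "y \<in> transf_words F" "x \<in> transf_words F"
  shows "y \<circ> x \<in> transf_words F"
  using assms by induct (auto simp: comp_assoc intro: transf_words.step)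

lemma transf_words_generator: "c \<in> F \<Longrightarrow> c \<in> transf_words F"
  using transf_words.step[OF transf_words.id] by fastforce

definition extended_action :: "'a set \<Rightarrow> (nat \<Rightarrow> 'a \<Rightarrow> 'a) \<Rightarrow> nat \<Rightarrow> 'a + nat \<Rightarrow> 'a + nat" where
  "extended_action V f i x =
    (case x of Inl v \<Rightarrow> if v \<in> V then Inl (f i v) else Inr i | Inr _ \<Rightarrow> Inr i)"

text \<open>The value at \<open>Inr 0\<close> reveals the index, so there are exactly
  \<open>k\<close> generators even if some \<open>f i\<close> coincide on \<open>V\<close>.\<close>

lemma inj_extended_action: "inj (extended_action V f)"
proof (rule injI)
  fix i j assume "extended_action V f i = extended_action V f j"
  then have "extended_action V f i (Inr 0) = extended_action V f j (Inr 0)"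
    by simp
  then show "i = j"
    by (simp add: extended_action_def)
qed

context
  fixes V :: "'a set" and f :: "nat \<Rightarrow> 'a \<Rightarrow> 'a" and k :: nat
  assumes f: "\<And>i v. i < k \<Longrightarrow> v \<in> V \<Longrightarrow> f i v \<in> V"
begin

lemma transf_words_extended_action_Inl:
  assumes "x \<in> transf_words (extended_action V f ` {..<k})" "v \<in> V"
  shows "x (Inl v) \<in> Inl ` V"
  using assms by induct (auto simp: extended_action_def f)

lemma transf_words_extended_action_Inr:
  assumes "x \<in> transf_words (extended_action V f ` {..<k})"
  shows "x (Inr n) \<in> range Inr"
  using assms by induct (auto simp: extended_action_def)

lemma finite_transf_words_extended_action:
  assumes "finite V"
  shows "finite (transf_words (extended_action V f ` {..<k}))"
proof (rule finite_subset)
  let ?B = "\<lambda>i. {x. \<forall>p. (p \<in> Inl ` V \<longrightarrow> x p \<in> Inl ` V) \<and> (p \<notin> Inl ` V \<longrightarrow> x p = Inr i)}"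
  show "transf_words (extended_action V f ` {..<k}) \<subseteq> insert id (\<Union>i<k. ?B i)"
  proof
    fix x assume "x \<in> transf_words (extended_action V f ` {..<k})"
    then show "x \<in> insert id (\<Union>i<k. ?B i)"
    proof induct
      case (step x c)
      then obtain i where i: "i < k" "c = extended_action V f i"
        by auto
      have "c p \<in> Inl ` V" if "p \<in> Inl ` V" for p
        using that i f by (auto simp: extended_action_def)
      moreover have "c p = Inr i" if "p \<notin> Inl ` V" for p
        using that i by (auto simp: extended_action_def split: sum.split)
      ultimately have "c \<circ> x \<in> ?B i"
        using step(2) by (auto; force)
      then show ?case
        using i by blast
    qed simp
  qed
  show "finite (insert id (\<Union>i<k. ?B i))"
    using assms by (intro finite.insertI finite_UN_I finite_set_of_finite_funs) auto
qed

end

section \<open>The monoid of words and constant maps belonging to a digraph\<close>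

theorem corollary3p9:
  fixes k :: nat and G :: "'a pair_pre_digraph"
  assumes "k \<ge> 1"
    and "pair_fin_digraph G"
    and "\<And>v. v \<in> pverts G \<Longrightarrow>
      1 \<le> card (out_neighbors (with_proj G) v) \<and> card (out_neighbors (with_proj G) v) \<le> k"
  shows "\<exists>(M :: nat monoid) C.
    monoid M \<and> finite (carrier M) \<and> C \<subseteq> carrier M \<and> card C = k \<and>
    digraph_iso (with_proj G)
      (remove_component (with_proj (cayley_digraph M C)) \<one>\<^bsub>M\<^esub>)"
proof -
  interpret pair_fin_digraph G by fact
  let ?V = "pverts G"
  have "\<forall>v\<in>?V. \<exists>g. g ` {..<k} = out_neighbors (with_proj G) v"
    using assms(3) ex_enumeration_of_card_le by blast
  then obtain g where g: "\<And>v. v \<in> ?V \<Longrightarrow> g v ` {..<k} = out_neighbors (with_proj G) v"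
    by metis
  \<comment> \<open>Reading the enumerations chosen at each vertex index by index yields
    \<open>k\<close> self-maps of \<open>?V\<close>.\<close>
  define f where "f i v = g v i" for i v
  have f: "f i v \<in> ?V" if "i < k" "v \<in> ?V" for i v
  proof -
    have "f i v \<in> out_neighbors (with_proj G) v"
      using g that by (auto simp: f_def)
    then show ?thesis
      by (auto simp: out_neighbors_def dest: in_arcsD2)
  qed
  define C where "C = extended_action ?V f ` {..<k}"
  define \<psi> :: "'a \<Rightarrow> 'a + nat \<Rightarrow> 'a + nat" where "\<psi> v = (\<lambda>_. Inl v)" for v
  define M :: "('a + nat \<Rightarrow> 'a + nat) monoid" where
    "M = \<lparr>carrier = transf_words C \<union> \<psi> ` ?V, mult = \<lambda>x y. y \<circ> x, one = id\<rparr>"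
  have "C \<subseteq> transf_words C"
    by (auto intro: transf_words_generator)
  have const_absorbs: "\<psi> v \<circ> x = \<psi> v" for v x
    by (simp add: \<psi>_def comp_def)
  have const_moved: "x \<circ> \<psi> v \<in> \<psi> ` ?V" if "x \<in> transf_words C" "v \<in> ?V" for x v
    using transf_words_extended_action_Inl[OF f that(1)[unfolded C_def] that(2)]
    by (auto simp: \<psi>_def comp_def)
  \<comment> \<open>Closure: any map followed by a constant is that constant, and a constant
    followed by a word is a constant with value in \<open>?V\<close>.\<close>
  have monoid_M: "monoid M"
    using const_moved
    by unfold_locales
      (auto simp: M_def const_absorbs comp_assoc transf_words.id intro: transf_words_comp)
  have finite_M: "finite (carrier M)"
    using finite_transf_words_extended_action[OF f] pair_finite_verts by (simp add: M_def C_def)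
  have inj: "inj_on \<psi> ?V"
    by (auto simp: \<psi>_def inj_on_def fun_eq_iff)
  \<comment> \<open>At \<open>Inr 0\<close> a word takes a value in \<open>range Inr\<close>,
    whereas \<open>\<psi> v\<close> takes the value \<open>Inl v\<close>.\<close>
  have disj: "transf_words C \<inter> \<psi> ` ?V = {}"
    using transf_words_extended_action_Inr[OF f, where n = 0] by (fastforce simp: C_def \<psi>_def)
  have reach: "(\<one>\<^bsub>M\<^esub>, x) \<in> (parcs (cayley_digraph M C))\<^sup>*" if "x \<in> transf_words C" for x
    using that
  proof induct
    case (step x c)
    then have "(x, c \<circ> x) \<in> parcs (cayley_digraph M C)"
      by (auto simp: cayley_digraph_def M_def)
    with step(2) show ?case
      by (rule rtrancl_into_rtrancl)
  qed (simp add: M_def)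
  have action: "(\<lambda>c. \<psi> v \<otimes>\<^bsub>M\<^esub> c) ` C = \<psi> ` out_neighbors (with_proj G) v" if "v \<in> ?V" for v
    using that
    by (simp add: g[OF that, symmetric] C_def image_image M_def \<psi>_def extended_action_def comp_def
        f_def)
  have "\<exists>(N :: nat monoid) D.
      monoid N \<and> finite (carrier N) \<and> D \<subseteq> carrier N \<and> card D = card C \<and>
      digraph_iso (with_proj G) (remove_component (with_proj (cayley_digraph N D)) \<one>\<^bsub>N\<^esub>)"
  proof (rule remove_component_cayley_one_iso_nat[OF monoid_M finite_M _ pair_wf_digraph_axioms inj
        _ disj _ _ reach action])
    show "C \<subseteq> carrier M"
      using \<open>C \<subseteq> transf_words C\<close> by (auto simp: M_def)
  qed (auto simp: M_def intro: transf_words.intros)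
  moreover have "card C = k"
    unfolding C_def by (simp add: card_image inj_on_subset[OF inj_extended_action])
  ultimately show ?thesis
    by simp
qed

end
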